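(* Let $X$ be a countably infinite set and let $A\leq\operatorname{Sym}(X)$ be closed with $\aleph_0\leq|A|<2^{\aleph_0}$. Then (in ZFC, independently of the Continuum Hypothesis): (i) $|A|=\aleph_0$, $A$ has a finite base, and $\operatorname{D}(A,X)$ is finite; (ii) if $A$ is subdegree-finite, then $A$ has infinite motion and $\operatorname{D}(A,X)=2$.
   Context: $\operatorname{Sym}(X)$ carries the permutation topology, whose open sets are generated by cosets of pointwise stabilizers of finite subsets of $X$; closed means closed in this topology (equivalently, $a\in\operatorname{Sym}(X)$ belongs to $A$ whenever for every finite $Y\subseteq X$ some $b\in A$ agrees with $a$ on $Y$). A base is a subset $Y\subseteq X$ with trivial pointwise stabilizer in $A$. $\operatorname{D}(A,X)$ is the least cardinal $d$ such that some $d$-coloring of $X$ is preserved only by the identity of $A$. $A$ is subdegree-finite if all orbits of every point stabilizer $A_x$ are finite. The motion of $A$ is the minimum over nonidentity $a\in A$ of $|\{x\in X:ax\neq x\}|$; infinite motion means this is infinite. *)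

theory Defs
  imports "HOL-Analysis.Abstract_Topology" "HOL-Algebra.Group_Action" "HOL-Algebra.Bij"
begin

unbundle cardinal_syntax

section \<open>Permutation groups and the permutation topology\<close>

text \<open>
  \<^term>\<open>BijGroup X\<close> is the symmetric group of the set \<open>X\<close>; its elements are extensional on \<open>X\<close>, so
  a permutation of \<open>X\<close> is represented by exactly one function.
\<close>

definition pointwise_stabilizer :: "('a \<Rightarrow> 'a) set \<Rightarrow> 'a set \<Rightarrow> ('a \<Rightarrow> 'a) set"
  where "pointwise_stabilizer A Y = {a \<in> A. \<forall>y\<in>Y. a y = y}"

text \<open>
  It does not matter whether left or right cosets are used:
  \<open>S\<^sub>Y g = g S\<^bsub>Z\<^esub>\<close> with \<open>Z = g\<inverse> Y\<close>, where \<open>S\<^sub>Y\<close> is the pointwise stabilizer of \<open>Y\<close>.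
\<close>

definition permutation_topology :: "'a set \<Rightarrow> ('a \<Rightarrow> 'a) topology"
  where "permutation_topology X = topology_generated_by
    {g <#\<^bsub>BijGroup X\<^esub> pointwise_stabilizer (carrier (BijGroup X)) Y | g Y.
       g \<in> carrier (BijGroup X) \<and> finite Y \<and> Y \<subseteq> X}"

definition is_base :: "('a \<Rightarrow> 'a) set \<Rightarrow> 'a set \<Rightarrow> 'a set \<Rightarrow> bool"
  where "is_base A X Y \<longleftrightarrow> Y \<subseteq> X \<and> pointwise_stabilizer A Y = {\<one>\<^bsub>BijGroup X\<^esub>}"

definition point_stabilizer :: "('a \<Rightarrow> 'a) set \<Rightarrow> 'a set \<Rightarrow> 'a \<Rightarrow> ('a \<Rightarrow> 'a) set"
  where "point_stabilizer A X x = stabilizer (BijGroup X\<lparr>carrier := A\<rparr>) (\<lambda>a. a) x"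

definition subdegree_finite :: "('a \<Rightarrow> 'a) set \<Rightarrow> 'a set \<Rightarrow> bool"
  where "subdegree_finite A X \<longleftrightarrow>
    (\<forall>x\<in>X. \<forall>y\<in>X. finite (orbit (BijGroup X\<lparr>carrier := point_stabilizer A X x\<rparr>) (\<lambda>a. a) y))"

section \<open>Distinguishing number and motion\<close>

text \<open>
  Cardinals are relations \<open>r\<close> with \<^term>\<open>Card_order r\<close>, compared by \<open>\<le>o\<close> and determined only up to
  \<open>=o\<close>. The least member of a nonempty set of cardinals is therefore a choice among
  \<open>=o\<close>-equivalent ones.
\<close>

definition least_cardinal :: "'a rel set \<Rightarrow> 'a rel"
  where "least_cardinal R = (SOME r. r \<in> R \<and> (\<forall>r'\<in>R. r \<le>o r'))"

definition distinguishing_coloring :: "('a \<Rightarrow> 'a) set \<Rightarrow> 'a set \<Rightarrow> ('a \<Rightarrow> 'c) \<Rightarrow> bool"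
  where "distinguishing_coloring A X c \<longleftrightarrow>
    (\<forall>a\<in>A. (\<forall>x\<in>X. c (a x) = c x) \<longrightarrow> a = \<one>\<^bsub>BijGroup X\<^esub>)"

text \<open>
  Taking the colors from the type of the points is no restriction, since the identity is a
  distinguishing coloring; see \<open>distinguishing_number_least\<close> below.
\<close>

definition distinguishing_number :: "('a \<Rightarrow> 'a) set \<Rightarrow> 'a set \<Rightarrow> 'a rel"
  where "distinguishing_number A X = least_cardinal
    {d. Card_order d \<and> (\<exists>c. c \<in> X \<rightarrow> Field d \<and> distinguishing_coloring A X c)}"

text \<open>
  For the trivial group the minimum is over the empty set and \<open>motion\<close> is unspecified.
\<close>

definition motion :: "('a \<Rightarrow> 'a) set \<Rightarrow> 'a set \<Rightarrow> 'a rel"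
  where "motion A X = least_cardinal { |{x \<in> X. a x \<noteq> x}| | a. a \<in> A - {\<one>\<^bsub>BijGroup X\<^esub>}}"

section \<open>Basic facts\<close>

lemma least_cardinal:
  assumes "R \<noteq> {}" "\<And>r. r \<in> R \<Longrightarrow> Card_order r"
  shows "least_cardinal R \<in> R" "r \<in> R \<Longrightarrow> least_cardinal R \<le>o r"
proof -
  have "\<exists>r. r \<in> R \<and> (\<forall>r'\<in>R. r \<le>o r')"
    using exists_minim_Card_order[of R] assms by blast
  from someI_ex[OF this]
  show "least_cardinal R \<in> R" "r \<in> R \<Longrightarrow> least_cardinal R \<le>o r"
    unfolding least_cardinal_def by blast+
qed

lemma distinguishing_number_attained:
  fixes X :: "'a set"
  assumes "A \<subseteq> Bij X"
  shows "Card_order (distinguishing_number A X)"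
    and "\<exists>c. c \<in> X \<rightarrow> Field (distinguishing_number A X) \<and> distinguishing_coloring A X c"
    and "\<lbrakk>Card_order (d :: 'a rel); c \<in> X \<rightarrow> Field d; distinguishing_coloring A X c\<rbrakk>
      \<Longrightarrow> distinguishing_number A X \<le>o d"
proof -
  let ?R = "{d :: 'a rel. Card_order d \<and> (\<exists>c. c \<in> X \<rightarrow> Field d \<and> distinguishing_coloring A X c)}"
  have "distinguishing_coloring A X (\<lambda>x. x)"
    using assms unfolding distinguishing_coloring_def Bij_def BijGroup_def
    by (auto simp: extensional_def fun_eq_iff restrict_def)
  hence "|X| \<in> ?R" by (auto simp: Field_card_of card_of_card_order_on)
  hence ne: "?R \<noteq> {}" by blast
  note L = least_cardinal[OF ne, folded distinguishing_number_def]
  show "Card_order (distinguishing_number A X)"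
    "\<exists>c. c \<in> X \<rightarrow> Field (distinguishing_number A X) \<and> distinguishing_coloring A X c"
    using L(1) by auto
  show "distinguishing_number A X \<le>o d"
    if "Card_order d" "c \<in> X \<rightarrow> Field d" "distinguishing_coloring A X c" for d :: "'a rel" and c
    using L(2) that by auto
qed

lemma distinguishing_number_least:
  fixes d :: "'c rel"
  assumes "A \<subseteq> Bij X" "Card_order d" "c \<in> X \<rightarrow> Field d" "distinguishing_coloring A X c"
  shows "distinguishing_number A X \<le>o d"
proof -
  define h where "h = inv_into X c"
  have h: "h ` c ` X \<subseteq> X" "inj_on h (c ` X)"
    unfolding h_def by (auto intro: inv_into_into inj_on_inv_into)
  have "distinguishing_coloring A X (h \<circ> c)"
    unfolding distinguishing_coloring_def
  proof (intro ballI impI)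
    fix a assume a: "a \<in> A" and eq: "\<forall>x\<in>X. (h \<circ> c) (a x) = (h \<circ> c) x"
    have "c (a x) = c x" if "x \<in> X" for x
    proof -
      have "a x \<in> X" using a assms(1) that by (auto simp: Bij_def bij_betw_def)
      then show ?thesis using eq that inj_onD[OF h(2), of "c (a x)" "c x"] by auto
    qed
    then show "a = \<one>\<^bsub>BijGroup X\<^esub>"
      using a assms(4) by (auto simp: distinguishing_coloring_def)
  qed
  then have "distinguishing_number A X \<le>o |h ` c ` X|"
    by (intro distinguishing_number_attained(3)[OF assms(1)])
       (auto simp: Field_card_of card_of_card_order_on)
  also have "|h ` c ` X| \<le>o |c ` X|" by (rule card_of_image)
  also have "|c ` X| \<le>o |Field d|" using assms(3) by (intro card_of_mono1) auto
  also have "|Field d| =o d" using assms(2) by (rule card_of_Field_ordIso)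
  finally show ?thesis .
qed

lemma motion_attained:
  assumes "a \<in> A" "a \<noteq> \<one>\<^bsub>BijGroup X\<^esub>"
  shows "\<exists>b\<in>A. b \<noteq> \<one>\<^bsub>BijGroup X\<^esub> \<and> motion A X = |{x \<in> X. b x \<noteq> x}|"
    and "motion A X \<le>o |{x \<in> X. a x \<noteq> x}|"
proof -
  let ?R = "{|{x \<in> X. a x \<noteq> x}| | a. a \<in> A - {\<one>\<^bsub>BijGroup X\<^esub>}}"
  have ne: "?R \<noteq> {}" using assms by blast
  have "Card_order r" if "r \<in> ?R" for r using that by (auto simp: card_of_Card_order)
  note L = least_cardinal[OF ne this, folded motion_def]
  show "\<exists>b\<in>A. b \<noteq> \<one>\<^bsub>BijGroup X\<^esub> \<and> motion A X = |{x \<in> X. b x \<noteq> x}|"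
    using L(1) by auto
  show "motion A X \<le>o |{x \<in> X. a x \<noteq> x}|"
    using assms by (intro L(2)) auto
qed

lemma coset_pointwise_stabilizer:
  assumes g: "g \<in> Bij X" and Y: "Y \<subseteq> X"
  shows "g <#\<^bsub>BijGroup X\<^esub> pointwise_stabilizer (carrier (BijGroup X)) Y
    = {b \<in> Bij X. \<forall>y\<in>Y. b y = g y}" (is "?L = ?R")
proof
  interpret group "BijGroup X" by (rule group_BijGroup)
  have mult: "(a \<otimes>\<^bsub>BijGroup X\<^esub> b) x = a (b x)"
    if "a \<in> Bij X" "b \<in> Bij X" "x \<in> X" for a b x
    using that by (simp add: BijGroup_def compose_def)
  have car: "carrier (BijGroup X) = Bij X" by (simp add: BijGroup_def)
  show "?L \<subseteq> ?R"
    using g Y m_closed[of g]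
    by (auto simp: l_coset_def pointwise_stabilizer_def car mult subset_iff)
  show "?R \<subseteq> ?L"
  proof
    fix b assume b: "b \<in> ?R"
    let ?h = "inv\<^bsub>BijGroup X\<^esub> g \<otimes>\<^bsub>BijGroup X\<^esub> b"
    have ig: "inv\<^bsub>BijGroup X\<^esub> g \<in> Bij X" using g car inv_closed by auto
    have h: "?h \<in> Bij X" using ig b car m_closed by auto
    have "?h y = y" if "y \<in> Y" for y
    proof -
      have "?h y = (inv\<^bsub>BijGroup X\<^esub> g \<otimes>\<^bsub>BijGroup X\<^esub> g) y"
        using that Y b g ig by (auto simp: mult)
      also have "\<dots> = y"
        using g Y that car l_inv[of g] by (auto simp: BijGroup_def)
      finally show ?thesis .
    qed
    moreover have "b = g \<otimes>\<^bsub>BijGroup X\<^esub> ?h"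
      using g b ig car m_assoc[of g "inv\<^bsub>BijGroup X\<^esub> g" b] r_inv[of g] l_one[of b] by simp
    ultimately show "b \<in> ?L"
      using h unfolding l_coset_def pointwise_stabilizer_def car by blast
  qed
qed

lemma topspace_permutation_topology [simp]: "topspace (permutation_topology X) = Bij X"
proof -
  have "g \<in> \<Union>{g <#\<^bsub>BijGroup X\<^esub> pointwise_stabilizer (carrier (BijGroup X)) Y | g Y.
       g \<in> carrier (BijGroup X) \<and> finite Y \<and> Y \<subseteq> X}" if "g \<in> Bij X" for g
    using that coset_pointwise_stabilizer[of g X "{}"]
    by (intro UnionI[of "Bij X"]) (auto simp: BijGroup_def)
  then show ?thesis
    using coset_pointwise_stabilizer[of _ X]
    unfolding permutation_topology_def topology_generated_by_topspace
    by (auto simp: BijGroup_def)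
qed

lemma openin_permutation_topology_iff:
  "openin (permutation_topology X) U \<longleftrightarrow> U \<subseteq> Bij X \<and>
    (\<forall>g\<in>U. \<exists>Y. finite Y \<and> Y \<subseteq> X \<and> {b \<in> Bij X. \<forall>y\<in>Y. b y = g y} \<subseteq> U)" (is "_ \<longleftrightarrow> ?P U")
proof
  let ?S = "{g <#\<^bsub>BijGroup X\<^esub> pointwise_stabilizer (carrier (BijGroup X)) Y | g Y.
       g \<in> carrier (BijGroup X) \<and> finite Y \<and> Y \<subseteq> X}"
  have car: "carrier (BijGroup X) = Bij X" by (simp add: BijGroup_def)
  have S: "?S = {{b \<in> Bij X. \<forall>y\<in>Y. b y = g y} | g Y. g \<in> Bij X \<and> finite Y \<and> Y \<subseteq> X}"
    unfolding car
    by (intro Collect_cong ex_cong1)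
       (auto simp: coset_pointwise_stabilizer[of _ X, unfolded car])
  show "?P U" if "openin (permutation_topology X) U"
  proof -
    have "generate_topology_on ?S U"
      using that unfolding permutation_topology_def by (rule openin_topology_generated_by)
    then show ?thesis
    proof induction
      case (Int a b)
      show ?case
      proof (intro conjI ballI)
        show "a \<inter> b \<subseteq> Bij X" using Int by blast
        fix g assume g: "g \<in> a \<inter> b"
        obtain Y where Y: "finite Y" "Y \<subseteq> X" "{b \<in> Bij X. \<forall>y\<in>Y. b y = g y} \<subseteq> a"
          using Int g by auto
        obtain Z where Z: "finite Z" "Z \<subseteq> X" "{b \<in> Bij X. \<forall>y\<in>Z. b y = g y} \<subseteq> b"
          using Int g by auto
        show "\<exists>Y. finite Y \<and> Y \<subseteq> X \<and> {b \<in> Bij X. \<forall>y\<in>Y. b y = g y} \<subseteq> a \<inter> b"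
          using Y Z by (intro exI[of _ "Y \<union> Z"]) blast
      qed
    next
      case (UN K)
      then show ?case by (meson Sup_least Sup_upper UnionE order_trans)
    next
      case (Basis s)
      then show ?case unfolding S by fastforce
    qed auto
  qed
  show "openin (permutation_topology X) U" if U: "?P U"
  proof (subst openin_subopen, intro ballI)
    fix g assume g: "g \<in> U"
    then obtain Y where Y: "finite Y" "Y \<subseteq> X" "{b \<in> Bij X. \<forall>y\<in>Y. b y = g y} \<subseteq> U"
      using U by blast
    have "{b \<in> Bij X. \<forall>y\<in>Y. b y = g y} \<in> ?S" using Y g U unfolding S by blast
    then have "openin (permutation_topology X) {b \<in> Bij X. \<forall>y\<in>Y. b y = g y}"
      unfolding permutation_topology_def by (rule topology_generated_by_Basis)
    then show "\<exists>T. openin (permutation_topology X) T \<and> g \<in> T \<and> T \<subseteq> U"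
      using Y g U by blast
  qed
qed

lemma closedin_permutation_topology_iff:
  "closedin (permutation_topology X) A \<longleftrightarrow> A \<subseteq> Bij X \<and>
    (\<forall>a\<in>Bij X. (\<forall>Y. finite Y \<and> Y \<subseteq> X \<longrightarrow> (\<exists>b\<in>A. \<forall>y\<in>Y. b y = a y)) \<longrightarrow> a \<in> A)"
proof (cases "A \<subseteq> Bij X")
  case True
  then have *: "{b \<in> Bij X. \<forall>y\<in>Y. b y = a y} \<subseteq> Bij X - A \<longleftrightarrow> \<not> (\<exists>b\<in>A. \<forall>y\<in>Y. b y = a y)"
    for a Y by blast
  show ?thesis
    using True unfolding closedin_def openin_permutation_topology_iff topspace_permutation_topology *
    by (simp add: Ball_def) metis
next
  case False
  then show ?thesis by (simp add: closedin_def)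
qed

end

theory Submission
  imports Defs "HOL-Analysis.Urysohn"
begin

text \<open>
  If no finite set is a base, then \<open>A\<close> has no isolated points. The map \<open>a \<mapsto> (a, a\<inverse>)\<close> embeds \<open>A\<close> as
  a closed set into a countable power of a countable discrete space, and a nonempty perfect set in a
  completely metrizable space has at least the size of the continuum. So a small \<open>A\<close> has a finite base \<open>Y\<close>;
  then \<open>A\<close> embeds into \<open>X\<^sup>Y\<close>, and giving the points of \<open>Y\<close> private colors distinguishes.

  If moreover \<open>A\<close> is subdegree-finite, then only finitely many elements of \<open>A\<close> send a given point to
  another given point. If \<open>a \<noteq> 1\<close> had finite support, almost all conjugates of \<open>a\<close> would lie in one
  finite point stabilizer; infinitely many \<open>g\<close> would then give the same conjugate and hence send the
  support of \<open>a\<close> to the same finite set, a contradiction. Finally, for a countable group with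
  infinite motion, a 2-coloring is chosen greedily: for the \<open>n\<close>-th element \<open>a\<close>, some fresh point is
  made black and its image under \<open>a\<close> white.
\<close>

section \<open>Pointwise calculation in a permutation group\<close>

locale permutation_subgroup =
  fixes X :: "'a set" and A :: "('a \<Rightarrow> 'a) set"
  assumes subgroup_A: "subgroup A (BijGroup X)"
begin

sublocale S: group "BijGroup X"
  by (rule group_BijGroup)

abbreviation mult (infixl "\<cdot>" 70) where "a \<cdot> b \<equiv> a \<otimes>\<^bsub>BijGroup X\<^esub> b"
abbreviation one ("\<e>") where "\<e> \<equiv> \<one>\<^bsub>BijGroup X\<^esub>"
abbreviation inverse_of where "inverse_of a \<equiv> inv\<^bsub>BijGroup X\<^esub> a"

lemma carrier_eq: "carrier (BijGroup X) = Bij X"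
  by (simp add: BijGroup_def)

lemma in_Bij: "a \<in> A \<Longrightarrow> a \<in> Bij X"
  using subgroup.subset[OF subgroup_A] carrier_eq by auto

lemma one_in: "\<e> \<in> A"
  and mult_in: "\<lbrakk>a \<in> A; b \<in> A\<rbrakk> \<Longrightarrow> a \<cdot> b \<in> A"
  and inverse_in: "a \<in> A \<Longrightarrow> inverse_of a \<in> A"
  using subgroup_A by (auto simp: subgroup_def)

lemma apply_in: "\<lbrakk>a \<in> A; x \<in> X\<rbrakk> \<Longrightarrow> a x \<in> X"
  using in_Bij Bij_imp_funcset by blast

lemma inj_on_apply: "a \<in> A \<Longrightarrow> inj_on a X"
  using in_Bij by (auto simp: Bij_def bij_betw_def)

lemma mult_apply [simp]: "\<lbrakk>a \<in> A; b \<in> A; x \<in> X\<rbrakk> \<Longrightarrow> (a \<cdot> b) x = a (b x)"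
  using in_Bij by (simp add: BijGroup_def compose_def)

lemma one_apply [simp]: "x \<in> X \<Longrightarrow> \<e> x = x"
  by (simp add: BijGroup_def)

lemma inverse_apply [simp]:
  assumes "a \<in> A" "x \<in> X"
  shows "inverse_of a (a x) = x" and "a (inverse_of a x) = x"
proof -
  have "a \<in> carrier (BijGroup X)" using assms in_Bij carrier_eq by simp
  then have "inverse_of a \<cdot> a = \<e>" "a \<cdot> inverse_of a = \<e>" by simp_all
  then show "inverse_of a (a x) = x" "a (inverse_of a x) = x"
    using assms inverse_in[of a] mult_apply[of "inverse_of a" a x] mult_apply[of a "inverse_of a" x]
    by auto
qed

lemma Bij_eqI: "\<lbrakk>a \<in> Bij X; b \<in> Bij X; \<And>x. x \<in> X \<Longrightarrow> a x = b x\<rbrakk> \<Longrightarrow> a = b"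
  by (rule extensionalityI[of _ X]) (auto simp: Bij_def)

lemma eqI: "\<lbrakk>a \<in> A; b \<in> A; \<And>x. x \<in> X \<Longrightarrow> a x = b x\<rbrakk> \<Longrightarrow> a = b"
  using Bij_eqI in_Bij by blast

lemma one_iff: "a \<in> A \<Longrightarrow> a = \<e> \<longleftrightarrow> (\<forall>x\<in>X. a x = x)"
  using eqI[of a \<e>] one_in by auto

section \<open>Bases and what a finite base implies\<close>

lemma is_base_iff: "is_base A X Y \<longleftrightarrow> Y \<subseteq> X \<and> (\<forall>a\<in>A. (\<forall>y\<in>Y. a y = y) \<longrightarrow> a = \<e>)"
  using one_in by (auto simp: is_base_def pointwise_stabilizer_def)

text \<open>The quotient \<open>inverse_of b \<cdot> a\<close> fixes \<open>Y\<close> pointwise,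
  hence is the identity.\<close>

lemma base_eqI:
  assumes Y: "is_base A X Y" and ab: "a \<in> A" "b \<in> A" "\<And>y. y \<in> Y \<Longrightarrow> a y = b y"
  shows "a = b"
proof (rule eqI)
  have YX: "Y \<subseteq> X" using Y by (simp add: is_base_iff)
  have "inverse_of b \<cdot> a = \<e>"
    using Y ab inverse_in YX unfolding is_base_iff by (auto simp: mult_in subset_iff)
  then show "a x = b x" if "x \<in> X" for x
    using that ab inverse_in apply_in mult_apply[of "inverse_of b" a x]
    by (metis inverse_apply(2) one_apply)
qed (use ab in auto)

lemma inj_on_restrict_base: "is_base A X Y \<Longrightarrow> inj_on (\<lambda>a. restrict a Y) A"
  by (rule inj_onI, erule base_eqI) (auto, metis restrict_apply')

lemma countable_if_finite_base:
  assumes "countable X" "finite Y" "is_base A X Y"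
  shows "countable A"
proof -
  have "(\<lambda>a. restrict a Y) ` A \<subseteq> (\<Pi>\<^sub>E y\<in>Y. X)"
    using assms(3) apply_in by (auto simp: is_base_iff)
  moreover have "countable (\<Pi>\<^sub>E y\<in>Y. X)"
    using assms by (intro countable_PiE) auto
  ultimately show ?thesis
    using inj_on_restrict_base[OF assms(3)] countable_subset countable_image_inj_on by blast
qed

lemma distinguishing_number_finite_base:
  assumes "finite Y" "is_base A X Y"
  shows "distinguishing_number A X <o natLeq"
proof -
  \<comment> \<open>All points outside \<open>Y\<close> share the color \<open>None\<close>, so
    finitely many colors suffice. The color \<open>Some y\<close> occurs only at \<open>y\<close>,
    so an element preserving the coloring fixes \<open>Y\<close> pointwise.\<close>
  let ?c = "\<lambda>x. if x \<in> Y then Some x else None" and ?d = "|insert None (Some ` Y)|"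
  have "distinguishing_coloring A X ?c"
    unfolding distinguishing_coloring_def
  proof (intro ballI impI)
    fix a assume a: "a \<in> A" "\<forall>x\<in>X. ?c (a x) = ?c x"
    have "a y = y" if "y \<in> Y" for y
      using a(2)[rule_format, of y] that assms(2) by (auto simp: is_base_iff split: if_splits)
    then show "a = \<e>" using assms(2) a(1) by (auto simp: is_base_iff)
  qed
  then have "distinguishing_number A X \<le>o ?d"
    using in_Bij by (intro distinguishing_number_least[where c = ?c])
      (auto simp: Field_card_of card_of_card_order_on)
  also have "?d <o natLeq"
    using assms(1) by (simp flip: finite_iff_ordLess_natLeq)
  finally show ?thesis .
qed

section \<open>Perfect sets and the size of closed groups\<close>

text \<open>A pointwise limit of permutations can fail to be surjective. Recording the inverses as
  well forces limits to be bijections, so that the image of a closed group is closed in the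
  product.\<close>

lemma perfect_image:
  fixes T E
  defines "T \<equiv> product_topology (\<lambda>x. discrete_topology (X \<times> X)) X"
    and "E \<equiv> \<lambda>a. \<lambda>x\<in>X. (a x, inverse_of a x)"
  assumes closed: "closedin (permutation_topology X) A"
    and no_base: "\<And>Y. finite Y \<Longrightarrow> \<not> is_base A X Y"
  shows "T derived_set_of (E ` A) = E ` A"
proof
  show "T derived_set_of (E ` A) \<subseteq> E ` A"
  proof
    fix f assume f: "f \<in> T derived_set_of (E ` A)"
    then have fT: "f \<in> (\<Pi>\<^sub>E x\<in>X. X \<times> X)"
      by (auto simp: T_def in_derived_set_of)
    have approx: "\<exists>b\<in>A. \<forall>y\<in>Y. (b y, inverse_of b y) = f y" if Y: "finite Y" "Y \<subseteq> X" for Y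
    proof -
      \<comment> \<open>A basic neighborhood of \<open>f\<close> that prescribes the value of
        \<open>f\<close> at each point of \<open>Y\<close>; singletons are open because the factors
        are discrete.\<close>
      let ?U = "\<Pi>\<^sub>E x\<in>X. if x \<in> Y then {f x} else X \<times> X"
      have "{x \<in> X. (if x \<in> Y then {f x} else X \<times> X) \<noteq> X \<times> X} \<subseteq> Y" by auto
      then have "openin T ?U"
        unfolding T_def using fT Y finite_subset
        by (subst openin_PiE_gen) (auto simp: PiE_iff split: if_splits)
      moreover have "f \<in> ?U" using fT by (auto simp: PiE_iff)
      ultimately obtain g where "g \<in> E ` A" "g \<in> ?U"
        using f unfolding in_derived_set_of by blast
      then obtain b where b: "b \<in> A" "E b \<in> ?U" by auto
      have "(b y, inverse_of b y) = f y" if "y \<in> Y" for y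
        using PiE_mem[OF b(2), of y] that Y by (auto simp: E_def)
      then show ?thesis using b by blast
    qed
    define a where "a = (\<lambda>x\<in>X. fst (f x))"
    define a' where "a' = (\<lambda>x\<in>X. snd (f x))"
    have aX: "a x \<in> X" "a' x \<in> X" if "x \<in> X" for x
      using PiE_mem[OF fT that] that by (auto simp: a_def a'_def)
    have inv: "a' (a x) = x" "a (a' x) = x" if x: "x \<in> X" for x
    proof -
      \<comment> \<open>Both inverse laws at \<open>x\<close> involve only these three points, so
        they carry over from a single approximating \<open>b\<close>.\<close>
      have "{x, a x, a' x} \<subseteq> X" using x aX by auto
      from approx[OF _ this]
      obtain b where b: "b \<in> A" "\<forall>y\<in>{x, a x, a' x}. (b y, inverse_of b y) = f y" by auto
      have "b y = a y \<and> inverse_of b y = a' y" if "y \<in> {x, a x, a' x}" for y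
      proof -
        have "y \<in> X" using that x aX by blast
        then show ?thesis using b(2)[rule_format, OF that, symmetric] by (simp add: a_def a'_def)
      qed
      then show "a' (a x) = x" "a (a' x) = x"
        using inverse_apply[OF b(1) x] by auto
    qed
    have "bij_betw a X X"
      by (rule bij_betw_byWitness[where f' = a']) (use inv aX in auto)
    then have "a \<in> Bij X" by (simp add: Bij_def a_def)
    moreover have "\<exists>b\<in>A. \<forall>y\<in>Y. b y = a y" if Y: "finite Y \<and> Y \<subseteq> X" for Y
    proof -
      obtain b where b: "b \<in> A" "\<forall>y\<in>Y. (b y, inverse_of b y) = f y"
        using approx[of Y] Y by auto
      have "b y = a y" if y: "y \<in> Y" for y
        using b(2)[rule_format, OF y, symmetric] y Y by (auto simp: a_def)
      then show ?thesis using b(1) by blast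
    qed
    ultimately have a: "a \<in> A"
      using closed unfolding closedin_permutation_topology_iff by blast
    have "E a = f"
    proof (rule extensionalityI[of _ X])
      fix x assume x: "x \<in> X"
      have "inverse_of a x = a' x"
        using inverse_apply(1)[OF a, of "a' x"] inv(2)[OF x] aX[OF x] by simp
      then show "E a x = f x" using x by (simp add: E_def a_def a'_def)
    qed (use fT in \<open>auto simp: E_def PiE_iff\<close>)
    then show "f \<in> E ` A" using a by auto
  qed
next
  show "E ` A \<subseteq> T derived_set_of (E ` A)"
  proof (rule image_subsetI)
    fix a assume a: "a \<in> A"
    have "E a \<in> topspace T" using a apply_in inverse_in by (auto simp: T_def E_def)
    moreover have "\<exists>g. g \<noteq> E a \<and> g \<in> E ` A \<and> g \<in> W" if W: "E a \<in> W" "openin T W" for W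
    proof -
      obtain U where U: "finite {x \<in> X. U x \<noteq> X \<times> X}" "E a \<in> Pi\<^sub>E X U" "Pi\<^sub>E X U \<subseteq> W"
        using W unfolding T_def openin_product_topology_alt by fastforce
      define Y where "Y = {x \<in> X. U x \<noteq> X \<times> X}"
      \<comment> \<open>Fixing \<open>Y\<close> makes \<open>a \<cdot> h\<close> agree with
        \<open>a\<close> on \<open>Y\<close>; fixing the preimage of \<open>Y\<close> under
        \<open>a\<close> makes their inverses agree on \<open>Y\<close>.\<close>
      have "finite (Y \<union> inverse_of a ` Y)" "Y \<union> inverse_of a ` Y \<subseteq> X"
        using U(1) a apply_in inverse_in by (auto simp: Y_def)
      with no_base[of "Y \<union> inverse_of a ` Y"]
      obtain h where h: "h \<in> A" "h \<noteq> \<e>" "\<forall>y \<in> Y \<union> inverse_of a ` Y. h y = y"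
        unfolding is_base_iff by blast
      have ah: "a \<cdot> h \<in> A" using a h mult_in by blast
      have inv: "inverse_of (a \<cdot> h) y = inverse_of a y" if "y \<in> Y" for y
      proof -
        have y: "y \<in> X" using that by (simp add: Y_def)
        have "(a \<cdot> h) (inverse_of a y) = y"
          using a h that y inverse_in apply_in by simp
        then show ?thesis
          using inverse_apply(1)[OF ah, of "inverse_of a y"] y a inverse_in apply_in by simp
      qed
      have "E (a \<cdot> h) x \<in> U x" if x: "x \<in> X" for x
      proof (cases "x \<in> Y")
        case True
        then have "E (a \<cdot> h) x = E a x" using inv a h x by (simp add: E_def)
        then show ?thesis using PiE_mem[OF U(2) x] by simp
      next
        case False
        then have "U x = X \<times> X" using x by (simp add: Y_def)
        then show ?thesis using ah x apply_in inverse_in by (simp add: E_def)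
      qed
      then have "E (a \<cdot> h) \<in> W" using U(3) by (auto simp: E_def)
      moreover have "E (a \<cdot> h) \<noteq> E a"
      proof
        assume eq: "E (a \<cdot> h) = E a"
        have "h x = x" if x: "x \<in> X" for x
        proof -
          have "a (h x) = a x" using fun_cong[OF eq, of x] x a h by (simp add: E_def)
          then show ?thesis using inj_on_apply[OF a] x h apply_in by (meson inj_onD)
        qed
        then show False using h one_iff by blast
      qed
      ultimately show ?thesis using ah by blast
    qed
    ultimately show "E a \<in> T derived_set_of (E ` A)"
      by (auto simp: in_derived_set_of)
  qed
qed

lemma continuum_if_no_finite_base:
  assumes "countable X" "closedin (permutation_topology X) A" "\<And>Y. finite Y \<Longrightarrow> \<not> is_base A X Y"
  shows "(UNIV :: real set) \<lesssim> A"
proof -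
  let ?T = "product_topology (\<lambda>x. discrete_topology (X \<times> X)) X"
  let ?E = "\<lambda>a. \<lambda>x\<in>X. (a x, inverse_of a x)"
  \<comment> \<open>Complete metrizability of a product requires that all but countably many factors
    have at most one point.\<close>
  have "countable {i \<in> X. \<not> (\<exists>a. topspace (discrete_topology (X \<times> X)) \<subseteq> {a})}"
    by (rule countable_subset[OF _ assms(1)]) auto
  then have "completely_metrizable_space ?T"
    unfolding completely_metrizable_space_product_topology
    by (simp add: completely_metrizable_space_discrete_topology)
  moreover have "?E ` A \<noteq> {}" using one_in by blast
  ultimately have "(UNIV :: real set) \<lesssim> ?E ` A"
    using perfect_image[OF assms(2,3)] by (intro lepoll_perfect_set) auto
  then show ?thesis using image_lepoll lepoll_trans by blast
qed

section \<open>Subdegree-finite groups: stabilizers and supports\<close>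

text \<open>An element fixing \<open>x\<close> is determined by its values on \<open>Y\<close>, and
  each value lies in a finite orbit of the stabilizer of \<open>x\<close>.\<close>

lemma finite_stabilizer:
  assumes "finite Y" "is_base A X Y" "subdegree_finite A X" and x: "x \<in> X"
  shows "finite {a \<in> A. a x = x}"
proof -
  let ?O = "\<lambda>y. {a y | a. a \<in> A \<and> a x = x}"
  have "?O y = orbit (BijGroup X\<lparr>carrier := point_stabilizer A X x\<rparr>) (\<lambda>a. a) y" for y
    by (simp add: point_stabilizer_def stabilizer_def orbit_def)
  moreover have "Y \<subseteq> X" using assms(2) by (simp add: is_base_iff)
  ultimately have "finite (?O y)" if "y \<in> Y" for y
    using assms(3) x that unfolding subdegree_finite_def by (metis subsetD)
  then have "finite (\<Pi>\<^sub>E y\<in>Y. ?O y)" by (rule finite_PiE[OF assms(1)])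
  moreover have "(\<lambda>a. restrict a Y) ` {a \<in> A. a x = x} \<subseteq> (\<Pi>\<^sub>E y\<in>Y. ?O y)" by auto
  moreover have "inj_on (\<lambda>a. restrict a Y) {a \<in> A. a x = x}"
    using inj_on_restrict_base[OF assms(2)] by (rule inj_on_subset) auto
  ultimately show ?thesis using finite_imageD finite_subset by blast
qed

text \<open>If nonempty, the set is a left coset of the stabilizer of \<open>x\<close>.\<close>

lemma finite_transporter:
  assumes "finite {a \<in> A. a x = x}" and x: "x \<in> X"
  shows "finite {a \<in> A. a x = y}"
proof (cases "\<exists>g\<in>A. g x = y")
  case True
  then obtain g where g: "g \<in> A" "g x = y" by blast
  have "{a \<in> A. a x = y} \<subseteq> (\<lambda>h. g \<cdot> h) ` {a \<in> A. a x = x}"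
  proof
    fix a assume a: "a \<in> {a \<in> A. a x = y}"
    then have "inverse_of g \<cdot> a \<in> {a \<in> A. a x = x}"
      using g x inverse_in mult_in inverse_apply(1)[OF g(1) x] by simp
    moreover have "a = g \<cdot> (inverse_of g \<cdot> a)"
      by (rule eqI) (use a g inverse_in mult_in apply_in in auto)
    ultimately show "a \<in> (\<lambda>h. g \<cdot> h) ` {a \<in> A. a x = x}" by blast
  qed
  then show ?thesis using assms(1) finite_surj by blast
next
  case False
  then have "{a \<in> A. a x = y} = {}" by blast
  then show ?thesis by (simp only: finite.emptyI)
qed

lemma infinite_support:
  assumes "infinite A" "infinite X" and fin: "\<And>x. x \<in> X \<Longrightarrow> finite {a \<in> A. a x = x}"
    and a: "a \<in> A" "a \<noteq> \<e>"
  shows "infinite {x \<in> X. a x \<noteq> x}"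
proof
  define F where "F = {x \<in> X. a x \<noteq> x}"
  assume "finite {x \<in> X. a x \<noteq> x}"
  then have F: "finite F" "F \<subseteq> X" by (auto simp: F_def)
  obtain f where f: "f \<in> F" using a one_iff by (auto simp: F_def)
  obtain x where x: "x \<in> X" using assms(2) by fastforce
  define c where "c g = g \<cdot> a \<cdot> inverse_of g" for g
  have c_in: "c g \<in> A" if "g \<in> A" for g using that a inverse_in mult_in by (simp add: c_def)
  \<comment> \<open>The support of the conjugate \<open>c g\<close> is the image of \<open>F\<close>
    under \<open>g\<close>.\<close>
  have c_fix: "c g (g y) = g y \<longleftrightarrow> y \<notin> F" if "g \<in> A" "y \<in> X" for g y
    using that a mult_in inverse_in apply_in inj_on_apply[of g]
    by (auto simp: c_def F_def inj_on_def)
  have transp: "finite {g \<in> A. g y = z}" if "y \<in> X" for y z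
    using finite_transporter fin that by blast
  \<comment> \<open>For \<open>g\<close> in \<open>G\<close> no point of \<open>F\<close> is sent to
    \<open>x\<close>, so \<open>c g\<close> fixes \<open>x\<close>. Only finitely many elements of
    \<open>A\<close> are discarded.\<close>
  define G where "G = A - (\<Union>y\<in>F. {g \<in> A. g y = x})"
  have "finite (\<Union>y\<in>F. {g \<in> A. g y = x})" using F transp by auto
  then have "infinite G" unfolding G_def using assms(1) by (rule Diff_infinite_finite)
  moreover have "c ` G \<subseteq> {b \<in> A. b x = x}"
  proof (rule image_subsetI)
    fix g assume g: "g \<in> G"
    have "inverse_of g x \<notin> F" using g x by (auto simp: G_def)
    then show "c g \<in> {b \<in> A. b x = x}"
      using c_fix[of g "inverse_of g x"] g x c_in apply_in inverse_in by (auto simp: G_def)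
  qed
  then have "finite (c ` G)" using fin[OF x] finite_subset by blast
  ultimately obtain b where b: "infinite {g \<in> G. c g = b}"
    using pigeonhole_infinite[of G c] by blast
  then obtain g0 where g0: "g0 \<in> G" "c g0 = b"
    by (metis (mono_tags, lifting) empty_Collect_eq finite.emptyI)
  \<comment> \<open>Both \<open>g\<close> and \<open>g0\<close> carry \<open>F\<close> onto the
    support of \<open>b\<close>. Hence \<open>f\<close> has only finitely many possible images under
    such \<open>g\<close>, each attained by finitely many \<open>g\<close>.\<close>
  have "g f \<in> g0 ` F" if g: "g \<in> G" "c g = b" for g
  proof -
    have gA: "g \<in> A" "g0 \<in> A" using g g0 by (auto simp: G_def)
    have fX: "f \<in> X" "g f \<in> X" "inverse_of g0 (g f) \<in> X"
      using f F gA apply_in inverse_in by auto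
    have "b (g f) \<noteq> g f" using c_fix[of g f] gA fX f g by auto
    then have "inverse_of g0 (g f) \<in> F"
      using c_fix[of g0 "inverse_of g0 (g f)"] gA fX g0 by auto
    then show ?thesis using gA fX by (metis imageI inverse_apply(2))
  qed
  then have "{g \<in> G. c g = b} \<subseteq> (\<Union>z\<in>g0 ` F. {g \<in> A. g f = z})" by (auto simp: G_def)
  moreover have "finite (\<Union>z\<in>g0 ` F. {g \<in> A. g f = z})" using F f transp by auto
  ultimately show False using b finite_subset by blast
qed

section \<open>Distinguishing 2-colorings\<close>

lemma two_coloring_infinite_motion:
  assumes "countable A" and inf: "\<And>a. \<lbrakk>a \<in> A; a \<noteq> \<e>\<rbrakk> \<Longrightarrow> infinite {x \<in> X. a x \<noteq> x}"
  obtains c :: "'a \<Rightarrow> bool" where "distinguishing_coloring A X c"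
proof (cases "A - {\<e>} = {}")
  case True
  then have "distinguishing_coloring A X (\<lambda>_. True)" by (auto simp: distinguishing_coloring_def)
  then show ?thesis by (rule that)
next
  case False
  \<comment> \<open>An enumeration of the nonidentity elements, with repetitions if there are only
    finitely many.\<close>
  define s where "s = from_nat_into (A - {\<e>})"
  have s: "s n \<in> A" "s n \<noteq> \<e>" for n
    using from_nat_into[OF False, of n] by (auto simp: s_def)
  \<comment> \<open>\<open>r\<close> is the black point chosen for \<open>s n\<close>, and
    \<open>s n r\<close> is to be white: \<open>r\<close> must avoid the earlier black and white
    points, and \<open>s n r\<close> the earlier black points and \<open>r\<close> itself.\<close>
  define P where "P f n r \<longleftrightarrow> r \<in> X \<and> s n r \<noteq> r \<and>
    (\<forall>i<n. r \<noteq> f i \<and> r \<noteq> s i (f i) \<and> s n r \<noteq> f i)" for f :: "nat \<Rightarrow> 'a" and n r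
  have "\<exists>f. \<forall>n. P f n (f n)"
  proof (rule dependent_wellorder_choice)
    show "P f n r = P g n r" if "\<And>i. i < n \<Longrightarrow> f i = g i" for r f g n
      using that by (auto simp: P_def)
    fix n f
    \<comment> \<open>The points excluded by the earlier choices. The last piece is finite because
      \<open>s n\<close> is injective on \<open>X\<close>.\<close>
    define B where "B = f ` {..<n} \<union> (\<lambda>i. s i (f i)) ` {..<n} \<union> (s n -` (f ` {..<n}) \<inter> X)"
    have "finite (s n -` (f ` {..<n}) \<inter> X)"
      using inj_on_apply[OF s(1)] by (intro finite_vimage_IntI) auto
    then have "finite B" unfolding B_def by blast
    then have "infinite ({x \<in> X. s n x \<noteq> x} - B)"
      using inf[OF s] by (rule Diff_infinite_finite)
    then have "{x \<in> X. s n x \<noteq> x} - B \<noteq> {}" using infinite_imp_nonempty by blast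
    then obtain r where "r \<in> {x \<in> X. s n x \<noteq> x} - B" by blast
    then have "P f n r" unfolding P_def B_def by auto
    then show "\<exists>r. P f n r" by blast
  qed
  then obtain f where f: "P f n (f n)" for n by blast
  \<comment> \<open>For \<open>m < n\<close> this is a condition on the later choice
    \<open>f n\<close>, for \<open>n < m\<close> one on the image of \<open>f m\<close>; for
    \<open>m = n\<close> it says that \<open>s m\<close> moves \<open>f m\<close>.\<close>
  have white: "s m (f m) \<noteq> f n" for m n
    using f[of m] f[of n] by (cases m n rule: linorder_cases) (auto simp: P_def)
  have "distinguishing_coloring A X (\<lambda>x. x \<in> range f)"
    unfolding distinguishing_coloring_def
  proof (intro ballI impI, rule ccontr)
    fix a assume a: "a \<in> A" "\<forall>x\<in>X. (a x \<in> range f) = (x \<in> range f)" "a \<noteq> \<e>"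
    then obtain m where "s m = a"
      using from_nat_into_surj[of "A - {\<e>}" a] assms(1) by (auto simp: s_def)
    then show False using a(2) f[of m] white[of m] by (auto simp: P_def)
  qed
  then show ?thesis by (rule that)
qed

text \<open>The coloring \<open>c\<close> gives the upper bound. For the lower bound, the
  nonidentity \<open>a\<close> must change the color of some point under any distinguishing
  coloring, so two colors occur.\<close>

lemma distinguishing_number_two:
  assumes "a \<in> A" "a \<noteq> \<e>" and c: "distinguishing_coloring A X (c :: 'a \<Rightarrow> bool)"
  shows "distinguishing_number A X =o ctwo"
proof -
  let ?D = "distinguishing_number A X"
  have AB: "A \<subseteq> Bij X" using in_Bij by auto
  have "?D \<le>o ctwo"
    using c by (intro distinguishing_number_least[OF AB])
      (auto simp: ctwo_def Field_card_of card_of_card_order_on)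
  moreover have "ctwo \<le>o ?D"
  proof -
    obtain d where d: "d \<in> X \<rightarrow> Field ?D" "distinguishing_coloring A X d"
      using distinguishing_number_attained(2)[OF AB] by blast
    obtain x where x: "x \<in> X" "d (a x) \<noteq> d x"
      using d(2) assms(1,2) by (auto simp: distinguishing_coloring_def)
    have "inj (\<lambda>b. if b then d (a x) else d x)" using x by (auto simp: inj_def)
    moreover have "range (\<lambda>b. if b then d (a x) else d x) \<subseteq> Field ?D"
      using d(1) x(1) apply_in[OF assms(1) x(1)] by auto
    ultimately have "ctwo \<le>o |Field ?D|" unfolding ctwo_def card_of_ordLeq[symmetric] by blast
    also have "|Field ?D| =o ?D"
      by (rule card_of_Field_ordIso[OF distinguishing_number_attained(1)[OF AB]])
    finally show ?thesis .
  qed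
  ultimately show ?thesis by (simp add: ordIso_iff_ordLeq)
qed

end

section \<open>Comparison with the continuum and conclusion\<close>

text \<open>Both the reals and \<open>ctwo ^c natLeq\<close> have the size of the power set of the
  naturals.\<close>

lemma not_small_if_real_lepoll:
  assumes "(UNIV :: real set) \<lesssim> B"
  shows "\<not> |B| <o ctwo ^c natLeq"
proof -
  have "(UNIV :: nat set set) \<lesssim> B"
    using assms nat_sets_eqpoll_reals lepoll_trans2 eqpoll_imp_lepoll lepoll_trans by blast
  then have "|Pow (UNIV :: nat set)| \<le>o |B|"
    by (auto simp: lepoll_def card_of_ordLeq[symmetric])
  moreover have "ctwo ^c natLeq =o |Pow (UNIV :: nat set)|"
    unfolding ctwo_def cexp_def Field_card_of Field_natLeq
    by (rule ordIso_symmetric[OF card_of_Pow_Func])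
  ultimately have "ctwo ^c natLeq \<le>o |B|" by (rule ordIso_ordLeq_trans[rotated])
  then show ?thesis using not_ordLess_ordLeq by blast
qed

theorem theorem3p6:
  fixes X :: "'a set" and A :: "('a \<Rightarrow> 'a) set"
  assumes "countable X" and "infinite X"
    and "subgroup A (BijGroup X)"
    and "closedin (permutation_topology X) A"
    and "natLeq \<le>o |A|" and "|A| <o ctwo ^c natLeq"
  shows "|A| =o natLeq \<and> (\<exists>Y. finite Y \<and> is_base A X Y) \<and> distinguishing_number A X <o natLeq \<and>
    (subdegree_finite A X \<longrightarrow>
      cinfinite (motion A X) \<and> distinguishing_number A X =o ctwo)"
proof -
  interpret permutation_subgroup X A by (rule permutation_subgroup.intro) (rule assms)
  obtain Y where Y: "finite Y" "is_base A X Y"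
    using continuum_if_no_finite_base assms(1,4,6) not_small_if_real_lepoll by blast
  have A: "countable A" "infinite A"
    using countable_if_finite_base[OF assms(1) Y] assms(5) infinite_iff_natLeq_ordLeq by blast+
  have "|A| \<le>o |UNIV :: nat set|"
    using A(1) by (auto simp: countable_def card_of_ordLeq[symmetric])
  then have "|A| =o natLeq"
    using assms(5) ordLeq_ordIso_trans[OF _ card_of_nat] by (auto simp: ordIso_iff_ordLeq)
  moreover have "cinfinite (motion A X) \<and> distinguishing_number A X =o ctwo"
    if sf: "subdegree_finite A X"
  proof
    have support: "infinite {x \<in> X. a x \<noteq> x}" if "a \<in> A" "a \<noteq> \<e>" for a
      using infinite_support[OF A(2) assms(2) finite_stabilizer[OF Y sf] that] by blast
    have "infinite (A - {\<e>})" using A(2) by simp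
    then obtain a where a: "a \<in> A" "a \<noteq> \<e>"
      by (metis Diff_iff all_not_in_conv finite.emptyI singletonI)
    show "cinfinite (motion A X)"
      using motion_attained(1)[OF a] support by (auto simp: cinfinite_def Field_card_of)
    obtain c :: "'a \<Rightarrow> bool" where "distinguishing_coloring A X c"
      using two_coloring_infinite_motion[OF A(1) support] .
    then show "distinguishing_number A X =o ctwo"
      using distinguishing_number_two a by blast
  qed
  ultimately show ?thesis
    using Y distinguishing_number_finite_base[OF Y] by blast
qed

end
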